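(* The set $\mathrm{EXL}=\{e\in\mathbb N : \mathcal L_e \text{ is TxtEx-learnable}\}$, where $\mathcal L_e$ is the uniformly computably enumerable family coded by $e$, is a $\Sigma^0_4$ set (that is, it has a $\Sigma_4^0$ description).
   Context: Fix a computable pairing function $\langle\cdot,\cdot\rangle:\mathbb N^2\to\mathbb N$ and a standard numbering $W_0,W_1,\dots$ of the computably enumerable (c.e.) sets. A number $e$ codes the uniformly computably enumerable (u.c.e.) family $\mathcal L_e=\{L_0,L_1,\dots\}$ whose $i$-th member (column) is $L_i=\{x:\langle i,x\rangle\in W_e\}$; the u.c.e. families are exactly those of this form. An enumeration is a function $f:\mathbb N\to\mathbb N$; $\mathrm{content}(f)=\{x:(\exists n)\,f(n)=x\}$; $f$ is an enumeration of (for) a set $A$ if $\mathrm{content}(f)=A$. $f\upharpoonright i$ is the initial segment of $f$ of length $i$, a finite string of natural numbers. A learning machine is a (possibly partial) computable function $M$ from finite strings of natural numbers to $\mathbb N$; a statement about a value of $M$ includes that this value is defined. $M$ TxtEx-identifies an enumeration $f$ if there is $n$ such that $\lim_{i\to\infty}M(f\upharpoonright i)=n$ (i.e. $M(f\upharpoonright i)=n$ for all sufficiently large $i$) and $W_n=\mathrm{content}(f)$. $M$ TxtEx-learns a c.e. set $A$ if it TxtEx-identifies every enumeration of $A$. $M$ TxtEx-learns a family of c.e. sets if it TxtEx-learns every member of the family. A family is TxtEx-learnable if some learning machine TxtEx-learns it. *)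

theory Defs
  imports Main "HOL-Library.Nat_Bijection"
begin

text \<open>
  Partial computable functions of one argument; several arguments are passed through the Cantor
  pairing function, which also serves as the fixed computable pairing.
\<close>

abbreviation pair :: "nat \<Rightarrow> nat \<Rightarrow> nat" where
  "pair x y \<equiv> prod_encode (x, y)"

datatype recf =
    RZero
  | RSucc
  | RFst
  | RSnd
  | RPair recf recf
  | RComp recf recf
  | RPrec recf recf
  | RMin recf

text \<open>
  \<open>None\<close> stands for divergence. \<open>RPrec f g\<close> is the \<open>h\<close> with \<open>h \<langle>a,0\<rangle> = f a\<close> and
  \<open>h \<langle>a,m+1\<rangle> = g \<langle>a,\<langle>m,h \<langle>a,m\<rangle>\<rangle>\<rangle>\<close>. \<open>RMin f\<close> is unbounded search for a zero of \<open>f \<langle>x,\<cdot>\<rangle>\<close>;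
  it diverges if some value before the first zero is undefined.
\<close>

primrec eval :: "recf \<Rightarrow> nat \<Rightarrow> nat option" where
  "eval RZero x = Some 0"
| "eval RSucc x = Some (Suc x)"
| "eval RFst x = Some (fst (prod_decode x))"
| "eval RSnd x = Some (snd (prod_decode x))"
| "eval (RPair f g) x =
     Option.bind (eval f x) (\<lambda>u. Option.bind (eval g x) (\<lambda>v. Some (pair u v)))"
| "eval (RComp f g) x = Option.bind (eval g x) (eval f)"
| "eval (RPrec f g) x =
     (case prod_decode x of (a, n) \<Rightarrow>
        rec_nat (eval f a) (\<lambda>m r. Option.bind r (\<lambda>v. eval g (pair a (pair m v)))) n)"
| "eval (RMin f) x =
     (if \<exists>n. eval f (pair x n) = Some 0 \<and> (\<forall>m<n. eval f (pair x m) \<noteq> None)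
      then Some (LEAST n. eval f (pair x n) = Some 0) else None)"

primrec index :: "recf \<Rightarrow> nat" where
  "index RZero = 0"
| "index RSucc = 1"
| "index RFst = 2"
| "index RSnd = 3"
| "index (RPair f g) = 4 + 4 * pair (index f) (index g)"
| "index (RComp f g) = 5 + 4 * pair (index f) (index g)"
| "index (RPrec f g) = 6 + 4 * pair (index f) (index g)"
| "index (RMin f) = 7 + 4 * index f"

lemma inj_index: "inj index"
proof (rule injI)
  fix f g
  show "index f = index g \<Longrightarrow> f = g"
  proof (induction f arbitrary: g)
    case RZero then show ?case by (cases g) auto
  next
    case RSucc then show ?case by (cases g) auto
  next
    case RFst then show ?case by (cases g) auto
  next
    case RSnd then show ?case by (cases g) auto
  next
    case (RPair f1 f2) then show ?case by (cases g) (auto, presburger+)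
  next
    case (RComp f1 f2) then show ?case by (cases g) (auto, presburger+)
  next
    case (RPrec f1 f2) then show ?case by (cases g) (auto, presburger+)
  next
    case (RMin f) then show ?case by (cases g) (auto, presburger+)
  qed
qed

lemma surj_index: "surj index"
proof -
  have "\<exists>f. index f = n" for n
  proof (induction n rule: less_induct)
    case (less n)
    show ?case
    proof (cases "n < 4")
      case True
      then consider "n = 0" | "n = 1" | "n = 2" | "n = 3" by linarith
      then show ?thesis
        by cases (metis index.simps(1), metis index.simps(2), metis index.simps(3),
          metis index.simps(4))
    next
      case False
      define k where "k = (n - 4) div 4"
      obtain a b where ab: "pair a b = k" by (metis prod_decode_inverse surj_pair)
      have "a \<le> k" "b \<le> k"
        using le_prod_encode_1[of a b] le_prod_encode_2[of b a] ab by auto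
      moreover have "k < n" using False by (simp add: k_def)
      ultimately obtain f g h where "index f = a" "index g = b" "index h = k"
        using less by (meson le_less_trans)
      moreover have "n = 4 + 4 * k \<or> n = 5 + 4 * k \<or> n = 6 + 4 * k \<or> n = 7 + 4 * k"
        using False unfolding k_def by presburger
      ultimately show ?thesis
        using ab index.simps(5-8) by metis
    qed
  qed
  then show ?thesis by (metis surjI)
qed

text \<open>By the two lemmas above, \<open>inv index\<close> is a genuine inverse, so every number is an index of
  exactly one program.\<close>

definition phi :: "nat \<Rightarrow> nat \<Rightarrow> nat option" where
  "phi e = eval (inv index e)"

definition W :: "nat \<Rightarrow> nat set" where
  "W e = {x. phi e x \<noteq> None}"

definition column :: "nat \<Rightarrow> nat \<Rightarrow> nat set" where
  "column e i = {x. pair i x \<in> W e}"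

definition uce_family :: "nat \<Rightarrow> nat set set" where
  "uce_family e = range (column e)"

definition content :: "(nat \<Rightarrow> nat) \<Rightarrow> nat set" where
  "content f = {x. \<exists>n. f n = x}"

definition enumeration_of :: "(nat \<Rightarrow> nat) \<Rightarrow> nat set \<Rightarrow> bool" where
  "enumeration_of f A \<longleftrightarrow> content f = A"

definition initial_segment :: "(nat \<Rightarrow> nat) \<Rightarrow> nat \<Rightarrow> nat list" where
  "initial_segment f i = map f [0..<i]"

text \<open>Strings are coded by the bijection \<open>list_encode\<close>.\<close>

definition learning_machine :: "(nat list \<Rightarrow> nat option) \<Rightarrow> bool" where
  "learning_machine M \<longleftrightarrow> (\<exists>p. \<forall>s. M s = eval p (list_encode s))"

definition TxtEx_identifies :: "(nat list \<Rightarrow> nat option) \<Rightarrow> (nat \<Rightarrow> nat) \<Rightarrow> bool" where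
  "TxtEx_identifies M f \<longleftrightarrow>
     (\<exists>n. (\<exists>k. \<forall>i\<ge>k. M (initial_segment f i) = Some n) \<and> W n = content f)"

definition TxtEx_learns :: "(nat list \<Rightarrow> nat option) \<Rightarrow> nat set \<Rightarrow> bool" where
  "TxtEx_learns M A \<longleftrightarrow> (\<forall>f. enumeration_of f A \<longrightarrow> TxtEx_identifies M f)"

definition TxtEx_learns_family :: "(nat list \<Rightarrow> nat option) \<Rightarrow> nat set set \<Rightarrow> bool" where
  "TxtEx_learns_family M F \<longleftrightarrow> (\<forall>A\<in>F. TxtEx_learns M A)"

definition TxtEx_learnable :: "nat set set \<Rightarrow> bool" where
  "TxtEx_learnable F \<longleftrightarrow> (\<exists>M. learning_machine M \<and> TxtEx_learns_family M F)"

definition EXL :: "nat set" where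
  "EXL = {e. TxtEx_learnable (uce_family e)}"

definition computable_set :: "nat set \<Rightarrow> bool" where
  "computable_set A \<longleftrightarrow> (\<exists>p. \<forall>x. eval p x = Some (if x \<in> A then 1 else 0))"

text \<open>\<open>Sigma0 n\<close> is the class \<open>\<Sigma>\<^sup>0\<^sub>n\<close> of the arithmetical hierarchy. In the second clause
  \<open>Sigma0 n (- B)\<close> says that \<open>B\<close> is \<open>\<Pi>\<^sup>0\<^sub>n\<close>.\<close>

primrec Sigma0 :: "nat \<Rightarrow> nat set \<Rightarrow> bool" where
  "Sigma0 0 A \<longleftrightarrow> computable_set A"
| "Sigma0 (Suc n) A \<longleftrightarrow> (\<exists>B. Sigma0 n (- B) \<and> A = {x. \<exists>y. pair x y \<in> B})"

end

theory Submission imports Defs begin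

text \<open>
  Call a string \<open>s\<close> over \<open>A\<close> stabilizing for \<open>M\<close> if \<open>M s\<close> is defined and no extension of \<open>s\<close> over \<open>A\<close>
  makes \<open>M\<close> output a different value. If \<open>M\<close> learns a nonempty \<open>A\<close>, then a stabilizing string exists
  (otherwise one enumerates \<open>A\<close> while provoking infinitely many changes of mind), and the output on
  every stabilizing string is an index of \<open>A\<close> (extend it to an enumeration of \<open>A\<close>). Conversely, if
  these two properties hold, a machine that outputs the value of \<open>M\<close> on the least string that
  looks stabilizing so far learns \<open>A\<close>. The properties form a conjunction of a \<open>\<Sigma>\<^sup>0\<^sub>2\<close> and a
  \<open>\<Pi>\<^sup>0\<^sub>2\<close> condition, so that "some machine has them for all nonempty columns" has the form \<open>\<exists>\<Pi>\<^sup>0\<^sub>3\<close>.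
\<close>

section \<open>Total computable functions and decidable predicates\<close>

abbreviation pi1 :: "nat \<Rightarrow> nat" where
  "pi1 x \<equiv> fst (prod_decode x)"

abbreviation pi2 :: "nat \<Rightarrow> nat" where
  "pi2 x \<equiv> snd (prod_decode x)"

definition computable :: "(nat \<Rightarrow> nat) \<Rightarrow> bool" where
  "computable f \<longleftrightarrow> (\<exists>p. \<forall>x. eval p x = Some (f x))"

definition decidable :: "(nat \<Rightarrow> bool) \<Rightarrow> bool" where
  "decidable P \<longleftrightarrow> computable (\<lambda>x. if P x then 1 else 0)"

named_theorems computable_intros

lemma computable_comp: "computable f \<Longrightarrow> computable g \<Longrightarrow> computable (\<lambda>x. f (g x))"
  unfolding computable_def
proof (elim exE)
  fix p q
  assume "\<forall>x. eval p x = Some (f x)" and "\<forall>x. eval q x = Some (g x)"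
  then show "\<exists>p. \<forall>x. eval p x = Some (f (g x))"
    by (intro exI[of _ "RComp p q"]) simp
qed

lemma computable_id [computable_intros]: "computable (\<lambda>x. x)"
  unfolding computable_def by (rule exI[of _ "RPair RFst RSnd"]) simp

lemma computable_Suc [computable_intros]: "computable f \<Longrightarrow> computable (\<lambda>x. Suc (f x))"
  by (rule computable_comp[of Suc], unfold computable_def, rule exI[of _ RSucc]) auto

lemma computable_pi1 [computable_intros]: "computable f \<Longrightarrow> computable (\<lambda>x. pi1 (f x))"
  by (rule computable_comp[of pi1], unfold computable_def, rule exI[of _ RFst]) auto

lemma computable_pi2 [computable_intros]: "computable f \<Longrightarrow> computable (\<lambda>x. pi2 (f x))"
  by (rule computable_comp[of pi2], unfold computable_def, rule exI[of _ RSnd]) auto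

lemma computable_const [computable_intros]: "computable (\<lambda>x. n)"
proof (induction n)
  case 0
  show ?case unfolding computable_def by (rule exI[of _ RZero]) simp
next
  case (Suc n)
  then show ?case by (rule computable_Suc)
qed

lemma computable_pair [computable_intros]:
  "computable f \<Longrightarrow> computable g \<Longrightarrow> computable (\<lambda>x. pair (f x) (g x))"
  unfolding computable_def
proof (elim exE)
  fix p q
  assume "\<forall>x. eval p x = Some (f x)" and "\<forall>x. eval q x = Some (g x)"
  then show "\<exists>p. \<forall>x. eval p x = Some (pair (f x) (g x))"
    by (intro exI[of _ "RPair p q"]) simp
qed

text \<open>The parameter passed to \<open>RPrec\<close> is \<open>x\<close> itself, so that the
  step function may depend on it. The step function is assumed computable in its three arguments
  \<open>x\<close>, \<open>m\<close>, \<open>r\<close> packed into one number.\<close>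

lemma computable_rec_nat [computable_intros]:
  assumes "computable a" and "computable n"
    and "computable (\<lambda>z. g (pi1 z) (pi1 (pi2 z)) (pi2 (pi2 z)))"
  shows "computable (\<lambda>x. rec_nat (a x) (\<lambda>m r. g x m r) (n x))"
proof -
  obtain p q where p: "\<And>x. eval p x = Some (a x)"
    and q: "\<And>z. eval q z = Some (g (pi1 z) (pi1 (pi2 z)) (pi2 (pi2 z)))"
    using assms(1,3) unfolding computable_def by blast
  have "rec_nat (Some (a x)) (\<lambda>m r. Option.bind r (\<lambda>v. Some (g x m v))) k
      = Some (rec_nat (a x) (\<lambda>m r. g x m r) k)" for x k
    by (induction k) auto
  then have "eval (RPrec p q) z = Some (rec_nat (a (pi1 z)) (\<lambda>m r. g (pi1 z) m r) (pi2 z))" for z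
    by (simp add: p q split: prod.split)
  then have "computable (\<lambda>z. rec_nat (a (pi1 z)) (\<lambda>m r. g (pi1 z) m r) (pi2 z))"
    unfolding computable_def by blast
  from computable_comp[OF this computable_pair[OF computable_id assms(2)]] show ?thesis by simp
qed

lemma computable_diff [computable_intros]:
  assumes "computable f" and "computable g"
  shows "computable (\<lambda>x. f x - g x)"
proof -
  \<comment> \<open>The predecessor is a recursion that returns the counter and ignores the previous
    value; truncated subtraction iterates it.\<close>
  have pred: "n - 1 = rec_nat 0 (\<lambda>m r. m) n" for n :: nat by (cases n) auto
  have "a - b = rec_nat a (\<lambda>m r. rec_nat 0 (\<lambda>m r. m) r) b" for a b :: nat
    by (induction b) (auto simp: pred[symmetric])
  then show ?thesis by (simp add: computable_intros assms)
qed

lemma computable_if [computable_intros]: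
  assumes "decidable P" and "computable f" and "computable g"
  shows "computable (\<lambda>x. if P x then f x else g x)"
proof -
  \<comment> \<open>Branching is a recursion of length 1 or 0 whose base value is the negative
    branch.\<close>
  have "(\<lambda>x. if P x then f x else g x)
      = (\<lambda>x. rec_nat (g x) (\<lambda>m r. f x) (if P x then 1 else 0))"
    by auto
  moreover have "computable (\<lambda>x. rec_nat (g x) (\<lambda>m r. f x) (if P x then 1 else 0))"
    by (intro computable_intros assms assms(1)[unfolded decidable_def]
        computable_comp[OF assms(2) computable_pi1[OF computable_id]])
  ultimately show ?thesis by (simp only:)
qed

lemma decidable_comp: "decidable P \<Longrightarrow> computable f \<Longrightarrow> decidable (\<lambda>x. P (f x))"
  unfolding decidable_def by (rule computable_comp)

lemma decidable_eq_0 [computable_intros]: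
  assumes "computable f"
  shows "decidable (\<lambda>x. f x = 0)"
proof -
  have "(\<lambda>x. if f x = 0 then 1 else 0) = (\<lambda>x. 1 - f x)" by auto
  then show ?thesis using assms unfolding decidable_def by (simp only:) (intro computable_intros)
qed

lemma decidable_not [computable_intros]:
  assumes "decidable P"
  shows "decidable (\<lambda>x. \<not> P x)"
proof -
  have "((if P x then 1 else 0) = (0::nat)) = (\<not> P x)" for x by simp
  with decidable_eq_0[OF assms[unfolded decidable_def]] show ?thesis by (simp only:)
qed

lemma decidable_conj [computable_intros]:
  assumes "decidable P" and "decidable Q"
  shows "decidable (\<lambda>x. P x \<and> Q x)"
proof -
  have "(\<lambda>x. if P x \<and> Q x then 1 else 0) = (\<lambda>x. if P x then (if Q x then 1 else 0) else (0::nat))"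
    by auto
  then show ?thesis
    unfolding decidable_def[of "\<lambda>x. P x \<and> Q x"]
    by (simp only:) (intro computable_intros assms)
qed

lemma decidable_disj [computable_intros]:
  assumes "decidable P" and "decidable Q"
  shows "decidable (\<lambda>x. P x \<or> Q x)"
  using decidable_not[OF decidable_conj[OF decidable_not[OF assms(1)] decidable_not[OF assms(2)]]]
  by simp

lemma decidable_imp [computable_intros]:
  assumes "decidable P" and "decidable Q"
  shows "decidable (\<lambda>x. P x \<longrightarrow> Q x)"
  using decidable_disj[OF decidable_not[OF assms(1)] assms(2)] by simp

lemma decidable_eq [computable_intros]:
  assumes "computable f" and "computable g"
  shows "decidable (\<lambda>x. f x = g x)"
proof -
  have "decidable (\<lambda>x. f x - g x = 0 \<and> g x - f x = 0)" by (intro computable_intros assms)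
  moreover have "(f x - g x = 0 \<and> g x - f x = 0) = (f x = g x)" for x by auto
  ultimately show ?thesis by simp
qed

lemma decidable_all_less [computable_intros]:
  assumes "computable n" and "decidable (\<lambda>z. P (pi1 z) (pi2 z))"
  shows "decidable (\<lambda>x. \<forall>y<n x. P x y)"
proof -
  have "(if \<forall>y<k. P x y then 1 else 0) = rec_nat (1::nat) (\<lambda>m r. if P x m then r else 0) k" for x k
    by (induction k) (auto simp: less_Suc_eq)
  moreover have "decidable (\<lambda>z. P (pi1 z) (pi1 (pi2 z)))"
  proof -
    have "computable (\<lambda>z. pair (pi1 z) (pi1 (pi2 z)))"
      by (intro computable_intros)
    from decidable_comp[OF assms(2) this] show ?thesis by simp
  qed
  ultimately show ?thesis
    unfolding decidable_def[of "\<lambda>x. \<forall>y<n x. P x y"]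
    by (simp only:) (intro computable_intros assms)
qed

section \<open>Iteration, division by 4 and operations on list codes\<close>

lemma computable_funpow [computable_intros]:
  assumes "computable a" and "computable n" and "computable (\<lambda>z. g (pi1 z) (pi2 z))"
  shows "computable (\<lambda>x. (g x ^^ n x) (a x))"
proof -
  have "(g x ^^ k) y = rec_nat y (\<lambda>m r. g x r) k" for x k y by (induction k) auto
  moreover have "computable (\<lambda>z. g (pi1 z) (pi2 (pi2 z)))"
  proof -
    have "computable (\<lambda>z. pair (pi1 z) (pi2 (pi2 z)))"
      by (intro computable_intros)
    from computable_comp[OF assms(3) this] show ?thesis by simp
  qed
  ultimately show ?thesis by (simp only:) (intro computable_intros assms)
qed

text \<open>Needed to decode program numbers: from 4 on, \<open>index\<close> stores the outermost
  constructor in the residue modulo 4.\<close>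

lemma computable_mod_4 [computable_intros]:
  assumes "computable f"
  shows "computable (\<lambda>x. f x mod 4)"
proof -
  have "k mod 4 = rec_nat 0 (\<lambda>m r. if r = 3 then 0 else Suc r) k" for k :: nat
    by (induction k) (auto simp: mod_Suc)
  then show ?thesis by (simp only:) (intro computable_intros assms)
qed

lemma computable_div_4 [computable_intros]:
  assumes "computable f"
  shows "computable (\<lambda>x. f x div 4)"
proof -
  have "k div 4 = rec_nat 0 (\<lambda>m r. if Suc m mod 4 = 0 then Suc r else r) k" for k :: nat
    by (induction k) (auto simp: div_Suc)
  then show ?thesis by (simp only:) (intro computable_intros assms)
qed

text \<open>The fold iterates a map on states that pair the accumulator with the code of the
  remaining list. Each step on a nonempty list lowers that code and the empty list is left alone, so
  the code of the list is itself a sufficient number of iterations.\<close>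

lemma computable_foldl [computable_intros]:
  assumes "computable a" and "computable l"
    and "computable (\<lambda>z. g (pi1 z) (pi1 (pi2 z)) (pi2 (pi2 z)))"
  shows "computable (\<lambda>x. foldl (\<lambda>b y. g x b y) (a x) (list_decode (l x)))"
proof -
  define h where "h = (\<lambda>x s. if pi2 s = 0 then s
    else pair (g x (pi1 s) (pi1 (pi2 s - 1))) (pi2 (pi2 s - 1)))"
  have "(h x ^^ n) (pair b r) = pair (foldl (\<lambda>b y. g x b y) b (list_decode r)) 0"
    if "r \<le> n" for x n b r
    using that
  proof (induction n arbitrary: b r)
    case 0
    then show ?case by simp
  next
    case (Suc n)
    have unfold: "(h x ^^ Suc n) s = (h x ^^ n) (h x s)" for s
      by (simp only: funpow_Suc_right o_apply)
    show ?case
    proof (cases r)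
      case 0
      then have "h x (pair b r) = pair b r" by (simp add: h_def)
      with 0 Suc.IH[of r b] show ?thesis unfolding unfold by simp
    next
      case (Suc k)
      obtain u v where uv: "prod_decode k = (u, v)" by fastforce
      then have "k = pair u v" by (metis prod_decode_inverse)
      then have "v \<le> n" using Suc Suc.prems le_prod_encode_2[of v u] by simp
      moreover have "h x (pair b r) = pair (g x b u) v" by (simp add: h_def Suc uv)
      ultimately show ?thesis
        using Suc.IH[of v "g x b u"] unfolding unfold by (simp add: Suc uv)
    qed
  qed
  then have "foldl (\<lambda>b y. g x b y) (a x) (list_decode (l x)) = pi1 ((h x ^^ l x) (pair (a x) (l x)))"
    for x by simp
  moreover have "computable (\<lambda>z. g (pi1 z) (pi1 (pi2 z)) (pi1 (pi2 (pi2 z) - 1)))"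
  proof -
    have "computable (\<lambda>z. pair (pi1 z) (pair (pi1 (pi2 z)) (pi1 (pi2 (pi2 z) - 1))))"
      by (intro computable_intros)
    from computable_comp[OF assms(3) this] show ?thesis by simp
  qed
  ultimately show ?thesis
    unfolding h_def by (simp only:) (intro computable_intros assms)
qed

lemma decidable_ball_list [computable_intros]:
  assumes "computable l" and "decidable (\<lambda>z. P (pi1 z) (pi2 z))"
  shows "decidable (\<lambda>x. \<forall>y\<in>set (list_decode (l x)). P x y)"
proof -
  have "foldl (\<lambda>b y. if P x y then b else 0) b ys = (if \<forall>y\<in>set ys. P x y then b else 0)"
    for x ys and b :: nat
    by (induction ys arbitrary: b) auto
  then have "(if \<forall>y\<in>set (list_decode (l x)). P x y then 1 else 0)
      = foldl (\<lambda>b y. if P x y then b else 0) (1::nat) (list_decode (l x))" for x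
    by simp
  moreover have "decidable (\<lambda>z. P (pi1 z) (pi2 (pi2 z)))"
  proof -
    have "computable (\<lambda>z. pair (pi1 z) (pi2 (pi2 z)))"
      by (intro computable_intros)
    from decidable_comp[OF assms(2) this] show ?thesis by simp
  qed
  ultimately show ?thesis
    unfolding decidable_def[of "\<lambda>x. \<forall>y\<in>set (list_decode (l x)). P x y"]
    by (simp only:) (intro computable_intros assms)
qed

lemma decidable_subset_list [computable_intros]:
  assumes "computable k" and "computable l"
  shows "decidable (\<lambda>x. set (list_decode (k x)) \<subseteq> set (list_decode (l x)))"
proof -
  \<comment> \<open>Membership is phrased as a negated universal quantifier over the list, the form
    covered by \<open>decidable_ball_list\<close>.\<close>
  have "decidable (\<lambda>x. \<forall>y\<in>set (list_decode (k x)). \<not> (\<forall>z\<in>set (list_decode (l x)). z \<noteq> y))"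
    by (intro computable_intros assms computable_comp[OF assms(2) computable_pi1[OF computable_id]])
  moreover have "(\<forall>y\<in>set (list_decode (k x)). \<not> (\<forall>z\<in>set (list_decode (l x)). z \<noteq> y))
    = (set (list_decode (k x)) \<subseteq> set (list_decode (l x)))" for x by auto
  ultimately show ?thesis by simp
qed

definition append_code :: "nat \<Rightarrow> nat \<Rightarrow> nat" where
  "append_code s t = list_encode (list_decode s @ list_decode t)"

lemma computable_append_code [computable_intros]:
  assumes "computable f" and "computable g"
  shows "computable (\<lambda>x. append_code (f x) (g x))"
proof -
  \<comment> \<open>\<open>Suc (pair y b)\<close> codes the list with head \<open>y\<close> and tail
    \<open>b\<close>, so one fold reverses its argument; appending therefore takes two
    folds.\<close>
  have fold: "foldl (\<lambda>b y. Suc (pair y b)) t xs = list_encode (rev xs @ list_decode t)" for t xs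
    by (induction xs arbitrary: t) auto
  have "append_code (f x) (g x) = foldl (\<lambda>b y. Suc (pair y b)) (g x)
      (list_decode (foldl (\<lambda>b y. Suc (pair y b)) 0 (list_decode (f x))))" for x
    by (simp add: fold append_code_def)
  then show ?thesis by (simp only:) (intro computable_intros assms)
qed

lemma computable_Least:
  assumes "decidable (\<lambda>z. P (pi1 z) (pi2 z))"
  obtains q where "\<And>x. eval q x = (if \<exists>y. P x y then Some (LEAST y. P x y) else None)"
proof -
  have "computable (\<lambda>z. if P (pi1 z) (pi2 z) then 0 else 1)" by (intro computable_intros assms)
  then obtain p where "\<And>z. eval p z = Some (if P (pi1 z) (pi2 z) then 0 else 1)"
    unfolding computable_def by blast
  then have "eval (RMin p) x = (if \<exists>y. P x y then Some (LEAST y. P x y) else None)" for x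
    by simp
  then show thesis by (rule that)
qed

section \<open>A universal machine\<close>

text \<open>
  A stack machine whose configurations are numbers: \<open>Eval e x K\<close> is about to run program number
  \<open>e\<close> on \<open>x\<close>, and \<open>Return x K\<close> passes the value \<open>x\<close> to the top frame of the stack \<open>K\<close>. The frame tags
  2 and 3 belong to \<open>RPair\<close>, the tags 4, 5 and 6 to \<open>RComp\<close>, \<open>RPrec\<close> and \<open>RMin\<close>.
\<close>

abbreviation Return :: "nat \<Rightarrow> nat \<Rightarrow> nat" where
  "Return x K \<equiv> pair 0 (pair x K)"

abbreviation Eval :: "nat \<Rightarrow> nat \<Rightarrow> nat \<Rightarrow> nat" where
  "Eval e x K \<equiv> pair (Suc e) (pair x K)"

abbreviation push :: "nat \<Rightarrow> nat \<Rightarrow> nat \<Rightarrow> nat" where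
  "push tag d K \<equiv> Suc (pair (pair tag d) K)"

text \<open>The data \<open>d\<close> of a frame are: for tag 2 the second program and its argument;
  for 3 the first value; for 4 the outer program; for 5 the step program, the parameter, the rounds
  done and the rounds left; for 6 the body, the parameter and the number being tested.\<close>

definition return_step :: "nat \<Rightarrow> nat \<Rightarrow> nat \<Rightarrow> nat \<Rightarrow> nat" where
  "return_step tag d x K =
    (if tag = 2 then Eval (pi1 d) (pi2 d) (push 3 x K)
     else if tag = 3 then Return (pair d x) K
     else if tag = 4 then Eval d x K
     else if tag = 5 then
       (if pi2 (pi2 (pi2 d)) = 0 then Return x K
        else Eval (pi1 d) (pair (pi1 (pi2 d)) (pair (pi1 (pi2 (pi2 d))) x))
          (push 5 (pair (pi1 d) (pair (pi1 (pi2 d))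
            (pair (Suc (pi1 (pi2 (pi2 d)))) (pi2 (pi2 (pi2 d)) - 1)))) K))
     else
       (if x = 0 then Return (pi2 (pi2 d)) K
        else Eval (pi1 d) (pair (pi1 (pi2 d)) (Suc (pi2 (pi2 d))))
          (push 6 (pair (pi1 d) (pair (pi1 (pi2 d)) (Suc (pi2 (pi2 d))))) K)))"

definition eval_step :: "nat \<Rightarrow> nat \<Rightarrow> nat \<Rightarrow> nat" where
  "eval_step e x K =
    (if e = 0 then Return 0 K
     else if e = 1 then Return (Suc x) K
     else if e = 2 then Return (pi1 x) K
     else if e = 3 then Return (pi2 x) K
     else if e mod 4 = 0 then
       Eval (pi1 ((e - 4) div 4)) x (push 2 (pair (pi2 ((e - 4) div 4)) x) K)
     else if e mod 4 = 1 then
       Eval (pi2 ((e - 4) div 4)) x (push 4 (pi1 ((e - 4) div 4)) K)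
     else if e mod 4 = 2 then
       Eval (pi1 ((e - 4) div 4)) (pi1 x)
         (push 5 (pair (pi2 ((e - 4) div 4)) (pair (pi1 x) (pair 0 (pi2 x)))) K)
     else
       Eval ((e - 4) div 4) (pair x 0) (push 6 (pair ((e - 4) div 4) (pair x 0)) K))"

text \<open>The stack 0 is empty, since \<open>push\<close> always yields a successor. Returning to
  the empty stack is a fixed point, so a halted configuration persists.\<close>

definition step :: "nat \<Rightarrow> nat" where
  "step s =
    (if pi1 s = 0 then
       (if pi2 (pi2 s) = 0 then s
        else return_step (pi1 (pi1 (pi2 (pi2 s) - 1))) (pi2 (pi1 (pi2 (pi2 s) - 1)))
          (pi1 (pi2 s)) (pi2 (pi2 (pi2 s) - 1)))
     else eval_step (pi1 s - 1) (pi1 (pi2 s)) (pi2 (pi2 s)))"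

lemma step_Return_push:
  "step (Return x (push tag d K)) = return_step tag d x K"
  by (simp add: step_def)

lemma step_Eval: "step (Eval e x K) = eval_step e x K"
  by (simp add: step_def)

lemma computable_step [computable_intros]:
  assumes "computable f"
  shows "computable (\<lambda>x. step (f x))"
  unfolding step_def return_step_def eval_step_def by (intro computable_intros assms)

lemma step_index:
  "step (Eval (index RZero) x K) = Return 0 K"
  "step (Eval (index RSucc) x K) = Return (Suc x) K"
  "step (Eval (index RFst) x K) = Return (pi1 x) K"
  "step (Eval (index RSnd) x K) = Return (pi2 x) K"
  "step (Eval (index (RPair f g)) x K) = Eval (index f) x (push 2 (pair (index g) x) K)"
  "step (Eval (index (RComp f g)) x K) = Eval (index g) x (push 4 (index f) K)"
  "step (Eval (index (RPrec f g)) (pair x n) K) =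
     Eval (index f) x (push 5 (pair (index g) (pair x (pair 0 n))) K)"
  "step (Eval (index (RMin f)) x K) =
     Eval (index f) (pair x 0) (push 6 (pair (index f) (pair x 0)) K)"
proof -
  have "(5 + 4 * k) mod 4 = 1" "(6 + 4 * k) mod 4 = 2" "(7 + 4 * k) mod 4 = 3"
    "(4 + 4 * k) mod 4 = 0" "Suc (4 * k) div 4 = k" "(2 + 4 * k) div 4 = k" "(3 + 4 * k) div 4 = k"
    for k :: nat by presburger+
  then show
    "step (Eval (index RZero) x K) = Return 0 K"
    "step (Eval (index RSucc) x K) = Return (Suc x) K"
    "step (Eval (index RFst) x K) = Return (pi1 x) K"
    "step (Eval (index RSnd) x K) = Return (pi2 x) K"
    "step (Eval (index (RPair f g)) x K) = Eval (index f) x (push 2 (pair (index g) x) K)"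
    "step (Eval (index (RComp f g)) x K) = Eval (index g) x (push 4 (index f) K)"
    "step (Eval (index (RPrec f g)) (pair x n) K) =
       Eval (index f) x (push 5 (pair (index g) (pair x (pair 0 n))) K)"
    "step (Eval (index (RMin f)) x K) =
       Eval (index f) (pair x 0) (push 6 (pair (index f) (pair x 0)) K)"
    unfolding step_Eval by (simp_all add: eval_step_def)
qed

lemma step_frame:
  "step (Return x (push 2 (pair e y) K)) = Eval e y (push 3 x K)"
  "step (Return x (push 3 y K)) = Return (pair y x) K"
  "step (Return x (push 4 e K)) = Eval e x K"
  "step (Return x (push 5 (pair e (pair a (pair m 0))) K)) = Return x K"
  "step (Return x (push 5 (pair e (pair a (pair m (Suc n)))) K)) =
     Eval e (pair a (pair m x)) (push 5 (pair e (pair a (pair (Suc m) n))) K)"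
  "step (Return 0 (push 6 (pair e (pair a n)) K)) = Return n K"
  "step (Return (Suc x) (push 6 (pair e (pair a n)) K)) =
     Eval e (pair a (Suc n)) (push 6 (pair e (pair a (Suc n))) K)"
  by (simp_all add: step_Return_push return_step_def)

section \<open>Every value of a program is reached by the machine\<close>

definition reaches :: "nat \<Rightarrow> nat \<Rightarrow> bool" where
  "reaches s s' \<longleftrightarrow> (\<exists>n. (step ^^ n) s = s')"

lemma reaches_refl [simp]: "reaches s s"
  unfolding reaches_def by (rule exI[of _ 0]) simp

lemma reaches_trans [trans]: "reaches s s' \<Longrightarrow> reaches s' s'' \<Longrightarrow> reaches s s''"
  unfolding reaches_def by (metis funpow_add o_apply)

lemma reaches_step: "reaches (step s) s' \<Longrightarrow> reaches s s'"
  unfolding reaches_def by (metis funpow_Suc_right o_apply)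

text \<open>This is the search loop of \<open>RMin\<close>, with the claim of
  \<open>reaches_eval\<close> for the body as a hypothesis. A round that tests \<open>m\<close>
  without success leads to the round for \<open>Suc m\<close>, hence the induction downwards from
  the zero \<open>n\<close>.\<close>

lemma reaches_Min:
  assumes f: "\<And>x y K. eval f x = Some y \<Longrightarrow> reaches (Eval (index f) x K) (Return y K)"
    and "m \<le> n" and "eval f (pair x n) = Some 0"
    and "\<And>k. k < n \<Longrightarrow> \<exists>v. eval f (pair x k) = Some (Suc v)"
  shows "reaches (Eval (index f) (pair x m) (push 6 (pair (index f) (pair x m)) K)) (Return n K)"
  using \<open>m \<le> n\<close>
proof (induction m rule: inc_induct)
  case base
  show ?case
    by (rule reaches_trans[OF f[OF assms(3)]], rule reaches_step) (simp add: step_frame)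
next
  case (step m)
  then obtain v where v: "eval f (pair x m) = Some (Suc v)" using assms(4) by blast
  show ?case
    by (rule reaches_trans[OF f[OF v]], rule reaches_step)
      (simp add: step_frame step.IH)
qed

lemma reaches_eval:
  "eval f x = Some y \<Longrightarrow> reaches (Eval (index f) x K) (Return y K)"
proof (induction f arbitrary: x y K)
  case (RPair f g)
  then obtain u v where uv: "eval f x = Some u" "eval g x = Some v" "y = pair u v"
    by (auto simp: bind_eq_Some_conv)
  show ?case
    apply (rule reaches_step, subst step_index)
    apply (rule reaches_trans[OF RPair.IH(1)[OF uv(1)]], rule reaches_step, subst step_frame)
    apply (rule reaches_trans[OF RPair.IH(2)[OF uv(2)]], rule reaches_step)
    apply (simp add: step_frame uv(3))
    done
next
  case (RComp f g)
  then obtain u where u: "eval g x = Some u" "eval f u = Some y"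
    by (auto simp: bind_eq_Some_conv)
  show ?case
    apply (rule reaches_step, subst step_index)
    apply (rule reaches_trans[OF RComp.IH(2)[OF u(1)]], rule reaches_step, subst step_frame)
    apply (rule RComp.IH(1)[OF u(2)])
    done
next
  case (RPrec f g)
  define r where "r a = rec_nat (eval f a) (\<lambda>m r. Option.bind r (\<lambda>v. eval g (pair a (pair m v))))" for a
  obtain a n where x: "x = pair a n" by (metis prod_decode_inverse surj_pair)
  have ry: "r a n = Some y" using RPrec.prems by (simp add: x r_def)
  \<comment> \<open>Loop invariant: after \<open>m\<close> rounds the frame records \<open>m\<close>
    rounds done and \<open>k\<close> left, with constant sum.\<close>
  have loop: "reaches (Eval (index f) a (push 5 (pair (index g) (pair a (pair 0 (m + k)))) K))
      (Return v (push 5 (pair (index g) (pair a (pair m k))) K))" if "r a m = Some v" for m k v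
    using that
  proof (induction m arbitrary: k v)
    case 0
    then show ?case using RPrec.IH(1) by (simp add: r_def)
  next
    case (Suc m)
    then obtain w where w: "r a m = Some w" "eval g (pair a (pair m w)) = Some v"
      by (auto simp: r_def bind_eq_Some_conv)
    have "reaches (Eval (index f) a (push 5 (pair (index g) (pair a (pair 0 (Suc m + k)))) K))
        (Return w (push 5 (pair (index g) (pair a (pair m (Suc k)))) K))"
      using Suc.IH[OF w(1), of "Suc k"] by simp
    also have "reaches \<dots> (Return v (push 5 (pair (index g) (pair a (pair (Suc m) k))) K))"
      by (rule reaches_step) (simp only: step_frame RPrec.IH(2)[OF w(2)])
    finally show ?case .
  qed
  have "reaches (Eval (index f) a (push 5 (pair (index g) (pair a (pair 0 n))) K))
      (Return y (push 5 (pair (index g) (pair a (pair n 0))) K))"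
    using loop[OF ry, of 0] by simp
  also have "reaches \<dots> (Return y K)"
    by (rule reaches_step) (simp only: step_frame reaches_refl)
  finally show ?case unfolding x by - (rule reaches_step, simp only: step_index)
next
  case (RMin f)
  then have ex: "\<exists>n. eval f (pair x n) = Some 0 \<and> (\<forall>m<n. eval f (pair x m) \<noteq> None)"
    and y: "y = (LEAST n. eval f (pair x n) = Some 0)" by (auto split: if_splits)
  from ex obtain n where n: "eval f (pair x n) = Some 0" "\<forall>m<n. eval f (pair x m) \<noteq> None"
    by blast
  have y0: "eval f (pair x y) = Some 0" unfolding y using n(1) by (rule LeastI)
  have "y \<le> n" unfolding y using n(1) by (rule Least_le)
  \<comment> \<open>Below the least zero every value is nonzero, and it is defined because
    \<open>y\<close> does not exceed the witness \<open>n\<close>.\<close>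
  have "\<exists>v. eval f (pair x k) = Some (Suc v)" if "k < y" for k
  proof -
    have "eval f (pair x k) \<noteq> Some 0" using that not_less_Least unfolding y by blast
    moreover have "eval f (pair x k) \<noteq> None" using that n(2) \<open>y \<le> n\<close> by simp
    ultimately show ?thesis by (metis not0_implies_Suc option.exhaust)
  qed
  then show ?case
    using reaches_Min[OF RMin.IH le0 y0, of K] by - (rule reaches_step, simp only: step_index)
qed (rule reaches_step, simp only: step_index, simp)+

section \<open>Conversely, every halting run comes from a value\<close>

definition halted :: "nat \<Rightarrow> bool" where
  "halted s \<longleftrightarrow> pi1 s = 0 \<and> pi2 (pi2 s) = 0"

lemma halted_Return [simp]: "halted (Return x K) \<longleftrightarrow> K = 0"
  by (simp add: halted_def)

lemma not_halted_Eval [simp]: "\<not> halted (Eval e x K)"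
  by (simp add: halted_def)

lemma step_halted: "halted s \<Longrightarrow> step s = s"
  by (simp add: halted_def step_def)

lemma halts_Suc:
  assumes "halted ((step ^^ n) s)" and "\<not> halted s"
  obtains k where "n = Suc k" and "halted ((step ^^ k) (step s))"
  using assms by (cases n) (auto simp: funpow_swap1)

text \<open>No bound on the search is known in advance, so the induction is on the length of the
  run, with the starting point \<open>k\<close> of the search left general. The strict bound
  \<open>m < n\<close> in the hypothesis makes the run of the next round shorter.\<close>

lemma halts_Min:
  assumes f: "\<And>x K n. halted ((step ^^ n) (Eval (index f) x K)) \<Longrightarrow>
      \<exists>y m. m < n \<and> eval f x = Some y \<and> halted ((step ^^ m) (Return y K))"
    and "halted ((step ^^ n)
      (Eval (index f) (pair x k) (push 6 (pair (index f) (pair x k)) K)))"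
  shows "\<exists>j m. m < n \<and> k \<le> j \<and> eval f (pair x j) = Some 0
      \<and> (\<forall>i. k \<le> i \<and> i < j \<longrightarrow> (\<exists>v. eval f (pair x i) = Some (Suc v)))
      \<and> halted ((step ^^ m) (Return j K))"
  using assms(2)
proof (induction n arbitrary: k rule: less_induct)
  case (less n)
  from f[OF less.prems] obtain y m where m: "m < n" "eval f (pair x k) = Some y"
    "halted ((step ^^ m) (Return y (push 6 (pair (index f) (pair x k)) K)))" by blast
  from halts_Suc[OF m(3)] obtain l where l: "m = Suc l"
    "halted ((step ^^ l) (step (Return y (push 6 (pair (index f) (pair x k)) K))))" by auto
  show ?case
  proof (cases y)
    case 0
    with l m show ?thesis by (intro exI[of _ k] exI[of _ l]) (auto simp: step_frame)
  next
    case (Suc v)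
    have "l < n" using l(1) m(1) by simp
    moreover have "halted ((step ^^ l)
        (Eval (index f) (pair x (Suc k)) (push 6 (pair (index f) (pair x (Suc k))) K)))"
      using l(2) Suc by (simp add: step_frame)
    ultimately obtain j i where ji: "i < l" "Suc k \<le> j"
      "eval f (pair x j) = Some 0"
      "\<forall>i. Suc k \<le> i \<and> i < j \<longrightarrow> (\<exists>v. eval f (pair x i) = Some (Suc v))"
      "halted ((step ^^ i) (Return j K))"
      using less.IH by blast
    have "\<exists>v. eval f (pair x i) = Some (Suc v)" if "k \<le> i" "i < j" for i
      using that ji(4) m(2) Suc by (cases "i = k") auto
    then show ?thesis using ji \<open>l < n\<close> by (intro exI[of _ j] exI[of _ i]) auto
  qed
qed

text \<open>A run that halts from some stack must first return the value of the program to that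
  stack. The rest of the run is claimed to be strictly shorter because \<open>halts_Min\<close>
  recurses on run lengths.\<close>

lemma halts_eval:
  "halted ((step ^^ n) (Eval (index f) x K)) \<Longrightarrow>
     \<exists>y m. m < n \<and> eval f x = Some y \<and> halted ((step ^^ m) (Return y K))"
proof (induction f arbitrary: x K n)
  case (RPair f g)
  from halts_Suc[OF RPair.prems] obtain a where a: "n = Suc a"
    "halted ((step ^^ a) (Eval (index f) x (push 2 (pair (index g) x) K)))"
    by (auto simp only: step_index not_halted_Eval)
  from RPair.IH(1)[OF a(2)] obtain u b where b: "b < a" "eval f x = Some u"
    "halted ((step ^^ b) (Return u (push 2 (pair (index g) x) K)))" by blast
  from halts_Suc[OF b(3)] obtain c where c: "b = Suc c"
    "halted ((step ^^ c) (Eval (index g) x (push 3 u K)))" by (auto simp: step_frame)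
  from RPair.IH(2)[OF c(2)] obtain v d where d: "d < c" "eval g x = Some v"
    "halted ((step ^^ d) (Return v (push 3 u K)))" by blast
  from halts_Suc[OF d(3)] obtain k where k: "d = Suc k"
    "halted ((step ^^ k) (Return (pair u v) K))" by (auto simp: step_frame)
  show ?case using a b c d k by (intro exI[of _ "pair u v"] exI[of _ k]) auto
next
  case (RComp f g)
  from halts_Suc[OF RComp.prems] obtain a where a: "n = Suc a"
    "halted ((step ^^ a) (Eval (index g) x (push 4 (index f) K)))"
    by (auto simp only: step_index not_halted_Eval)
  from RComp.IH(2)[OF a(2)] obtain u b where b: "b < a" "eval g x = Some u"
    "halted ((step ^^ b) (Return u (push 4 (index f) K)))" by blast
  from halts_Suc[OF b(3)] obtain c where c: "b = Suc c"
    "halted ((step ^^ c) (Eval (index f) u K))" by (auto simp: step_frame)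
  from RComp.IH(1)[OF c(2)] obtain y m where "m < c" "eval f u = Some y"
    "halted ((step ^^ m) (Return y K))" by blast
  then show ?case using a b c by (intro exI[of _ y] exI[of _ m]) auto
next
  case (RPrec f g)
  define r where "r a = rec_nat (eval f a) (\<lambda>m r. Option.bind r (\<lambda>v. eval g (pair a (pair m v))))" for a
  obtain a k where x: "x = pair a k" by (metis prod_decode_inverse surj_pair)
  from halts_Suc[OF RPrec.prems] obtain b where b: "n = Suc b"
    "halted ((step ^^ b) (Eval (index f) a (push 5 (pair (index g) (pair a (pair 0 k))) K)))"
    by (auto simp only: x step_index not_halted_Eval)
  \<comment> \<open>The halting run passes through the end of each of the \<open>k\<close> rounds,
    with the intermediate value of the recursion in hand.\<close>
  have loop: "\<exists>v m. m < b \<and> r a i = Some v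
      \<and> halted ((step ^^ m) (Return v (push 5 (pair (index g) (pair a (pair i (k - i)))) K)))"
    if "i \<le> k" for i
    using that
  proof (induction i)
    case 0
    with RPrec.IH(1)[OF b(2)] show ?case by (auto simp: r_def)
  next
    case (Suc i)
    then obtain v m where m: "m < b" "r a i = Some v"
      "halted ((step ^^ m) (Return v (push 5 (pair (index g) (pair a (pair i (k - i)))) K)))"
      by auto
    have "k - i = Suc (k - Suc i)" using Suc.prems by simp
    with halts_Suc[OF m(3)] obtain c where c: "m = Suc c"
      "halted ((step ^^ c) (Eval (index g) (pair a (pair i v))
         (push 5 (pair (index g) (pair a (pair (Suc i) (k - Suc i)))) K)))"
      by (auto simp: step_frame)
    from RPrec.IH(2)[OF c(2)] obtain w d where "d < c" "eval g (pair a (pair i v)) = Some w"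
      "halted ((step ^^ d) (Return w (push 5 (pair (index g) (pair a (pair (Suc i) (k - Suc i)))) K)))"
      by blast
    with m c show ?case by (intro exI[of _ w] exI[of _ d]) (auto simp: r_def)
  qed
  from loop[of k] obtain v m where m: "m < b" "r a k = Some v"
    "halted ((step ^^ m) (Return v (push 5 (pair (index g) (pair a (pair k 0))) K)))" by auto
  from halts_Suc[OF m(3)] obtain c where "m = Suc c" "halted ((step ^^ c) (Return v K))"
    by (auto simp: step_frame)
  with m b show ?case by (intro exI[of _ v] exI[of _ c]) (auto simp: x r_def)
next
  case (RMin f)
  from halts_Suc[OF RMin.prems] obtain b where b: "n = Suc b"
    "halted ((step ^^ b) (Eval (index f) (pair x 0) (push 6 (pair (index f) (pair x 0)) K)))"
    by (auto simp only: step_index not_halted_Eval)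
  from halts_Min[OF RMin.IH b(2)] obtain j m where j: "m < b" "eval f (pair x j) = Some 0"
    "\<forall>i<j. \<exists>v. eval f (pair x i) = Some (Suc v)" "halted ((step ^^ m) (Return j K))" by auto
  have "(LEAST i. eval f (pair x i) = Some 0) = j"
    using j(2,3) by (intro Least_equality) (auto simp: not_less[symmetric])
  moreover have "\<exists>i. eval f (pair x i) = Some 0 \<and> (\<forall>m<i. eval f (pair x m) \<noteq> None)"
    using j(2,3) by (intro exI[of _ j]) auto
  ultimately have "eval (RMin f) x = Some j" by simp
  then show ?case using b j by (intro exI[of _ j] exI[of _ m]) auto
qed (erule halts_Suc, rule not_halted_Eval, simp only: step_index, fastforce)+

section \<open>Step-bounded computation\<close>

definition run :: "nat \<Rightarrow> nat \<Rightarrow> nat \<Rightarrow> nat" where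
  "run e x t = (step ^^ t) (Eval e x 0)"

definition halts_in :: "nat \<Rightarrow> nat \<Rightarrow> nat \<Rightarrow> bool" where
  "halts_in e x t \<longleftrightarrow> halted (run e x t)"

definition result :: "nat \<Rightarrow> nat \<Rightarrow> nat \<Rightarrow> nat" where
  "result e x t = pi1 (pi2 (run e x t))"

lemma computable_result [computable_intros]:
  assumes "computable e" and "computable f" and "computable t"
  shows "computable (\<lambda>x. result (e x) (f x) (t x))"
  unfolding result_def run_def by (intro computable_intros assms)

lemma decidable_halts_in [computable_intros]:
  assumes "computable e" and "computable f" and "computable t"
  shows "decidable (\<lambda>x. halts_in (e x) (f x) (t x))"
  unfolding halts_in_def halted_def run_def by (intro computable_intros assms)

lemma run_halted_mono:
  assumes "halts_in e x t" and "t \<le> t'"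
  shows "run e x t' = run e x t"
proof -
  have "(step ^^ n) s = s" if "halted s" for n s
    using that by (induction n) (auto simp: step_halted)
  moreover have "run e x t' = (step ^^ (t' - t)) (run e x t)"
    using assms(2) by (simp add: run_def funpow_add[THEN fun_cong, unfolded o_apply, symmetric])
  ultimately show ?thesis using assms(1) by (simp add: halts_in_def)
qed

lemma halts_in_mono: "halts_in e x t \<Longrightarrow> t \<le> t' \<Longrightarrow> halts_in e x t'"
  using run_halted_mono unfolding halts_in_def by metis

lemma phi_index: "phi (index f) = eval f"
  by (simp add: phi_def inj_index)

lemma index_inv: "index (inv index e) = e"
  by (rule surj_f_inv_f[OF surj_index])

lemma halts_in_ex:
  assumes "phi e x = Some y"
  obtains t where "halts_in e x t" and "result e x t = y"
proof -
  have "reaches (Eval e x 0) (Return y 0)"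
    using reaches_eval[of "inv index e" x y 0] assms by (simp add: phi_def index_inv)
  then obtain t where "run e x t = Return y 0" unfolding reaches_def run_def by blast
  then show thesis by (intro that[of t]) (simp_all add: halts_in_def result_def)
qed

lemma halts_in_phi:
  assumes "halts_in e x t"
  shows "phi e x = Some (result e x t)"
proof -
  have "halted ((step ^^ t) (Eval (index (inv index e)) x 0))"
    using assms by (simp add: halts_in_def run_def index_inv)
  then obtain y where y: "phi e x = Some y" unfolding phi_def using halts_eval by blast
  then obtain t' where "halts_in e x t'" "result e x t' = y" by (rule halts_in_ex)
  then have "result e x t = y"
    using assms run_halted_mono unfolding result_def by (metis nle_le)
  with y show ?thesis by simp
qed

text \<open>A Kleene normal form: one existential quantifier over a decidable matrix. The upper
  bounds for the basic predicates below start from here or from the same time-bounded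
  simulation.\<close>

lemma phi_iff: "phi e x = Some y \<longleftrightarrow> (\<exists>t. halts_in e x t \<and> result e x t = y)"
  using halts_in_ex halts_in_phi by metis

section \<open>Closure properties of the arithmetical hierarchy\<close>

text \<open>Working with predicates instead of sets lets the closure rules follow the syntax of a
  formula under \<open>intro\<close>.\<close>

definition Sigma_pred :: "nat \<Rightarrow> (nat \<Rightarrow> bool) \<Rightarrow> bool" where
  "Sigma_pred n P \<longleftrightarrow> Sigma0 n {x. P x}"

definition Pi_pred :: "nat \<Rightarrow> (nat \<Rightarrow> bool) \<Rightarrow> bool" where
  "Pi_pred n P \<longleftrightarrow> Sigma_pred n (\<lambda>x. \<not> P x)"

lemma Sigma_pred_0: "Sigma_pred 0 P \<longleftrightarrow> decidable P"
  by (simp add: Sigma_pred_def decidable_def computable_def computable_set_def)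

lemma Sigma_pred_Suc:
  "Sigma_pred (Suc n) P \<longleftrightarrow> (\<exists>Q. Pi_pred n Q \<and> P = (\<lambda>x. \<exists>y. Q (pair x y)))"
proof
  assume "Sigma_pred (Suc n) P"
  then obtain B where "Sigma0 n (- B)" and "Collect P = {x. \<exists>y. pair x y \<in> B}"
    by (auto simp: Sigma_pred_def)
  then have "Sigma0 n (- B)" and "P = (\<lambda>x. \<exists>y. pair x y \<in> B)"
    by (simp_all add: set_eq_iff fun_eq_iff)
  then show "\<exists>Q. Pi_pred n Q \<and> P = (\<lambda>x. \<exists>y. Q (pair x y))"
    by (intro exI[of _ "\<lambda>x. x \<in> B"]) (auto simp: Pi_pred_def Sigma_pred_def Compl_eq)
next
  assume "\<exists>Q. Pi_pred n Q \<and> P = (\<lambda>x. \<exists>y. Q (pair x y))"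
  then obtain Q where "Pi_pred n Q" "P = (\<lambda>x. \<exists>y. Q (pair x y))" by blast
  then show "Sigma_pred (Suc n) P"
    unfolding Sigma_pred_def Sigma0.simps
    by (intro exI[of _ "Collect Q"]) (auto simp: Pi_pred_def Sigma_pred_def Collect_neg_eq)
qed

lemma Sigma_pred_not: "Sigma_pred n (\<lambda>x. \<not> P x) \<longleftrightarrow> Pi_pred n P"
  by (simp add: Pi_pred_def)

lemma Pi_pred_not: "Pi_pred n (\<lambda>x. \<not> P x) \<longleftrightarrow> Sigma_pred n P"
  by (simp add: Pi_pred_def)

lemma Sigma_pred_comp:
  "Sigma_pred n P \<Longrightarrow> computable f \<Longrightarrow> Sigma_pred n (\<lambda>x. P (f x))"
proof (induction n arbitrary: P f)
  case 0
  then show ?case by (simp add: Sigma_pred_0 decidable_comp)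
next
  case (Suc n)
  then obtain Q where Q: "Pi_pred n Q" "P = (\<lambda>x. \<exists>y. Q (pair x y))"
    by (auto simp: Sigma_pred_Suc)
  have "computable (\<lambda>z. pair (f (pi1 z)) (pi2 z))"
    by (intro computable_intros computable_comp[OF Suc.prems(2) computable_pi1[OF computable_id]])
  from Suc.IH[OF Q(1)[unfolded Pi_pred_def] this]
  have "Pi_pred n (\<lambda>z. Q (pair (f (pi1 z)) (pi2 z)))" by (simp add: Pi_pred_def)
  then show ?case
    unfolding Sigma_pred_Suc Q(2)
    by (intro exI[of _ "\<lambda>z. Q (pair (f (pi1 z)) (pi2 z))"]) simp
qed

lemma Pi_pred_comp: "Pi_pred n P \<Longrightarrow> computable f \<Longrightarrow> Pi_pred n (\<lambda>x. P (f x))"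
  unfolding Pi_pred_def by (rule Sigma_pred_comp)

lemma Sigma_pred_Pi_ex:
  assumes "Pi_pred n (\<lambda>z. P (pi1 z) (pi2 z))"
  shows "Sigma_pred (Suc n) (\<lambda>x. \<exists>y. P x y)"
  unfolding Sigma_pred_Suc by (rule exI[of _ "\<lambda>z. P (pi1 z) (pi2 z)"]) (simp add: assms)

lemma Sigma_pred_Suc_if_Pi:
  assumes "Pi_pred n P"
  shows "Sigma_pred (Suc n) P"
  using Sigma_pred_Pi_ex[OF Pi_pred_comp[OF assms computable_pi1[OF computable_id]]] by simp

lemma Sigma_pred_Suc_mono: "Sigma_pred n P \<Longrightarrow> Sigma_pred (Suc n) P"
proof (induction n arbitrary: P)
  case 0
  then show ?case
    by (intro Sigma_pred_Suc_if_Pi) (auto simp: Pi_pred_def Sigma_pred_0 intro: decidable_not)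
next
  case (Suc n)
  then obtain Q where "Pi_pred n Q" and P: "P = (\<lambda>x. \<exists>y. Q (pair x y))"
    by (auto simp: Sigma_pred_Suc)
  \<comment> \<open>The quantifier stays in place and only the matrix is raised by one
    level.\<close>
  then have "Pi_pred (Suc n) Q" using Suc.IH by (simp add: Pi_pred_def)
  then show ?case unfolding Sigma_pred_Suc[of "Suc n"] P by blast
qed

lemma Sigma_pred_mono:
  assumes "Sigma_pred m P" and "m \<le> n"
  shows "Sigma_pred n P"
  using assms(2,1) by (induction rule: dec_induct) (auto intro: Sigma_pred_Suc_mono)

lemma Sigma_pred_if_Pi: "Pi_pred m P \<Longrightarrow> m < n \<Longrightarrow> Sigma_pred n P"
  using Sigma_pred_mono[OF Sigma_pred_Suc_if_Pi] by (simp add: Suc_le_eq)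

lemma Pi_pred_if_Sigma: "Sigma_pred m P \<Longrightarrow> m < n \<Longrightarrow> Pi_pred n P"
  using Sigma_pred_if_Pi[of m "\<lambda>x. \<not> P x"] by (simp add: Pi_pred_def)

lemma Pi_pred_mono: "Pi_pred m P \<Longrightarrow> m \<le> n \<Longrightarrow> Pi_pred n P"
  unfolding Pi_pred_def by (rule Sigma_pred_mono)

text \<open>Two adjacent existential quantifiers contract to one over pairs. Level 0 is excluded
  because it has no leading quantifier to absorb the new one.\<close>

lemma Sigma_pred_ex:
  assumes "0 < n" and "Sigma_pred n (\<lambda>z. P (pi1 z) (pi2 z))"
  shows "Sigma_pred n (\<lambda>x. \<exists>y. P x y)"
proof -
  obtain k where n: "n = Suc k" using assms(1) by (cases n) auto
  with assms(2) obtain Q where Q: "Pi_pred k Q"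
    "(\<lambda>z. P (pi1 z) (pi2 z)) = (\<lambda>z. \<exists>y. Q (pair z y))"
    by (auto simp: Sigma_pred_Suc)
  have "computable (\<lambda>z. pair (pair (pi1 z) (pi1 (pi2 z))) (pi2 (pi2 z)))"
    by (intro computable_intros)
  then have "Pi_pred k (\<lambda>z. Q (pair (pair (pi1 z) (pi1 (pi2 z))) (pi2 (pi2 z))))"
    by (rule Pi_pred_comp[OF Q(1)])
  then have "Sigma_pred n (\<lambda>x. \<exists>w. Q (pair (pair x (pi1 w)) (pi2 w)))"
    unfolding n by (rule Sigma_pred_Pi_ex)
  moreover have "(\<exists>y. P x y) \<longleftrightarrow> (\<exists>w. Q (pair (pair x (pi1 w)) (pi2 w)))" for x
  proof -
    have "P x y \<longleftrightarrow> (\<exists>v. Q (pair (pair x y) v))" for y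
      using fun_cong[OF Q(2), of "pair x y"] by simp
    then show ?thesis by (metis fst_conv prod_encode_inverse snd_conv)
  qed
  ultimately show ?thesis by simp
qed

lemma Pi_pred_all:
  assumes "0 < n" and "Pi_pred n (\<lambda>z. P (pi1 z) (pi2 z))"
  shows "Pi_pred n (\<lambda>x. \<forall>y. P x y)"
  using Sigma_pred_ex[of n "\<lambda>x y. \<not> P x y"] assms by (simp add: Pi_pred_def)

text \<open>Both claims are proved together: passing to the matrix dualizes, so conjunction at one
  level rests on disjunction at the level below and vice versa. A conjunction pairs the two
  witnesses; a disjunction can share one.\<close>

lemma Sigma_pred_conj_disj:
  "Sigma_pred n P \<Longrightarrow> Sigma_pred n Q \<Longrightarrow> Sigma_pred n (\<lambda>x. P x \<and> Q x)"
  "Sigma_pred n P \<Longrightarrow> Sigma_pred n Q \<Longrightarrow> Sigma_pred n (\<lambda>x. P x \<or> Q x)"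
proof (induction n arbitrary: P Q)
  case 0
  {
    case 1
    then show ?case by (simp add: Sigma_pred_0 decidable_conj)
  next
    case 2
    then show ?case by (simp add: Sigma_pred_0 decidable_disj)
  }
next
  case (Suc n)
  have c1: "computable (\<lambda>z. pair (pi1 z) (pi1 (pi2 z)))"
    and c2: "computable (\<lambda>z. pair (pi1 z) (pi2 (pi2 z)))"
    by (intro computable_intros)+
  {
    case 1
    then obtain R S where R: "Pi_pred n R" "P = (\<lambda>x. \<exists>y. R (pair x y))"
      and S: "Pi_pred n S" "Q = (\<lambda>x. \<exists>y. S (pair x y))"
      by (auto simp: Sigma_pred_Suc)
    have "Pi_pred n (\<lambda>z. R (pair (pi1 z) (pi1 (pi2 z))) \<and> S (pair (pi1 z) (pi2 (pi2 z))))"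
      using Suc.IH(2)[OF Pi_pred_comp[OF R(1) c1, unfolded Pi_pred_def]
          Pi_pred_comp[OF S(1) c2, unfolded Pi_pred_def]]
      by (simp add: Pi_pred_def)
    from Sigma_pred_Pi_ex[OF this]
    have "Sigma_pred (Suc n) (\<lambda>x. \<exists>w. R (pair x (pi1 w)) \<and> S (pair x (pi2 w)))" .
    moreover have "(\<exists>w. R (pair x (pi1 w)) \<and> S (pair x (pi2 w))) \<longleftrightarrow> P x \<and> Q x" for x
      unfolding R(2) S(2) by (metis fst_conv prod_encode_inverse snd_conv)
    ultimately show ?case by simp
  next
    case 2
    then obtain R S where R: "Pi_pred n R" "P = (\<lambda>x. \<exists>y. R (pair x y))"
      and S: "Pi_pred n S" "Q = (\<lambda>x. \<exists>y. S (pair x y))"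
      by (auto simp: Sigma_pred_Suc)
    have "Pi_pred n (\<lambda>z. R z \<or> S z)"
      using Suc.IH(1)[OF R(1)[unfolded Pi_pred_def] S(1)[unfolded Pi_pred_def]]
      by (simp add: Pi_pred_def)
    then show ?case
      unfolding Sigma_pred_Suc R(2) S(2)
      by (intro exI[of _ "\<lambda>z. R z \<or> S z"]) auto
  }
qed

lemma Pi_pred_conj_disj:
  "Pi_pred n P \<Longrightarrow> Pi_pred n Q \<Longrightarrow> Pi_pred n (\<lambda>x. P x \<and> Q x)"
  "Pi_pred n P \<Longrightarrow> Pi_pred n Q \<Longrightarrow> Pi_pred n (\<lambda>x. P x \<or> Q x)"
  using Sigma_pred_conj_disj[of n "\<lambda>x. \<not> P x" "\<lambda>x. \<not> Q x"] by (simp_all add: Pi_pred_def)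

lemma decidable_Sigma_pred: "decidable P \<Longrightarrow> Sigma_pred n P"
  using Sigma_pred_mono[of 0 P n] by (simp add: Sigma_pred_0)

lemma decidable_Pi_pred: "decidable P \<Longrightarrow> Pi_pred n P"
  unfolding Pi_pred_def by (intro decidable_Sigma_pred decidable_not)

section \<open>Complexity of the basic predicates\<close>

lemma Sigma_pred_phi_eq:
  assumes "0 < n" and "computable e" and "computable f" and "computable g"
  shows "Sigma_pred n (\<lambda>x. phi (e x) (f x) = Some (g x))"
  unfolding phi_iff
  by (intro Sigma_pred_ex decidable_Sigma_pred computable_intros assms
      computable_comp[OF assms(2) computable_pi1[OF computable_id]]
      computable_comp[OF assms(3) computable_pi1[OF computable_id]]
      computable_comp[OF assms(4) computable_pi1[OF computable_id]])

text \<open>A common halting time for the finitely many members of the list removes the bounded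
  quantifier.\<close>

lemma Sigma_pred_list_subset_column:
  assumes "0 < n" and "computable l" and "computable e" and "computable i"
  shows "Sigma_pred n (\<lambda>x. set (list_decode (l x)) \<subseteq> column (e x) (i x))"
proof -
  have "set ys \<subseteq> column a b \<longleftrightarrow> (\<exists>t. \<forall>y\<in>set ys. halts_in a (pair b y) t)" for ys a b
  proof
    assume "set ys \<subseteq> column a b"
    then show "\<exists>t. \<forall>y\<in>set ys. halts_in a (pair b y) t"
    proof (induction ys)
      case Nil
      then show ?case by simp
    next
      case (Cons y ys)
      then obtain t where "\<forall>y\<in>set ys. halts_in a (pair b y) t" by auto
      moreover obtain v where "phi a (pair b y) = Some v"
        using Cons.prems by (auto simp: column_def W_def)
      then obtain t' where "halts_in a (pair b y) t'" by (rule halts_in_ex)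
      ultimately show ?case
        by (intro exI[of _ "max t t'"]) (auto intro: halts_in_mono)
    qed
  qed (auto simp: column_def W_def dest: halts_in_phi)
  moreover have "Sigma_pred n
    (\<lambda>x. \<exists>t. \<forall>y\<in>set (list_decode (l x)). halts_in (e x) (pair (i x) y) t)"
    by (intro Sigma_pred_ex decidable_Sigma_pred computable_intros assms
        computable_comp[OF assms(2) computable_pi1[OF computable_id]]
        computable_comp[OF assms(3) computable_pi1[OF computable_pi1[OF computable_id]]]
        computable_comp[OF assms(4) computable_pi1[OF computable_pi1[OF computable_id]]])
  ultimately show ?thesis by simp
qed

lemma Sigma_pred_W:
  assumes "0 < n" and "computable e" and "computable f"
  shows "Sigma_pred n (\<lambda>x. f x \<in> W (e x))"
proof -
  have "f x \<in> W (e x) \<longleftrightarrow> (\<exists>y. phi (e x) (f x) = Some y)" for x by (auto simp: W_def)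
  then show ?thesis
    by (simp only:) (intro Sigma_pred_ex Sigma_pred_phi_eq computable_intros assms
      computable_comp[OF assms(2) computable_pi1[OF computable_id]]
      computable_comp[OF assms(3) computable_pi1[OF computable_id]])
qed

text \<open>The last three rules place the \<open>\<Sigma>\<^sub>1\<close> atoms in
  \<open>\<Pi>\<^sub>n\<close> for every \<open>n\<close> above 1; what remains after
  \<open>intro\<close> is computability and comparisons of levels.\<close>

lemmas arithmetical_intros =
  Sigma_pred_conj_disj Pi_pred_conj_disj
  Sigma_pred_not[THEN iffD2] Pi_pred_not[THEN iffD2]
  Sigma_pred_W Sigma_pred_phi_eq Sigma_pred_list_subset_column
  Pi_pred_if_Sigma[OF Sigma_pred_W[OF zero_less_one]]
  Pi_pred_if_Sigma[OF Sigma_pred_phi_eq[OF zero_less_one]]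
  Pi_pred_if_Sigma[OF Sigma_pred_list_subset_column[OF zero_less_one]]

section \<open>Stabilizing sequences\<close>

text \<open>A relative of the locking sequences of learning theory, except that the value need not
  be an index of \<open>A\<close>. Since \<open>M\<close> may be partial, extensions on which it
  diverges are tolerated; for computable \<open>M\<close> and c.e. \<open>A\<close> this keeps the
  last clause \<open>\<Pi>\<^sub>1\<close> once \<open>M s\<close> is defined.\<close>

definition stabilizing :: "(nat list \<Rightarrow> nat option) \<Rightarrow> nat set \<Rightarrow> nat list \<Rightarrow> bool" where
  "stabilizing M A s \<longleftrightarrow> set s \<subseteq> A \<and> M s \<noteq> None \<and>
     (\<forall>r. set r \<subseteq> A \<longrightarrow> M (s @ r) \<noteq> None \<longrightarrow> M (s @ r) = M s)"

lemma set_initial_segment: "set (initial_segment f i) = f ` {..<i}"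
  by (auto simp: initial_segment_def)

lemma stabilizing_ex:
  fixes a :: "nat \<Rightarrow> nat"
  assumes learns: "TxtEx_learns M A" and a: "range a = A"
  shows "\<exists>s. stabilizing M A s"
proof (rule ccontr)
  assume "\<not> ?thesis"
  then have "\<exists>r. set s \<subseteq> A \<and> M s \<noteq> None \<longrightarrow>
      set r \<subseteq> A \<and> M (s @ r) \<noteq> None \<and> M (s @ r) \<noteq> M s" for s
    unfolding stabilizing_def by blast
  then obtain ext where ext: "set s \<subseteq> A \<Longrightarrow> M s \<noteq> None \<Longrightarrow>
      set (ext s) \<subseteq> A \<and> M (s @ ext s) \<noteq> None \<and> M (s @ ext s) \<noteq> M s" for s
    by metis
  \<comment> \<open>Each stage appends \<open>a n\<close>, which makes the limit exhaust
    \<open>A\<close>, and then, if \<open>M\<close> has a value there, an extension that changes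
    this value.\<close>
  define S where "S = rec_nat [] (\<lambda>n s. (s @ [a n]) @ (if M (s @ [a n]) = None then [] else ext (s @ [a n])))"
  have S_Suc: "S (Suc n) = (S n @ [a n]) @
      (if M (S n @ [a n]) = None then [] else ext (S n @ [a n]))" for n
    by (simp add: S_def)
  have S_sub: "set (S n) \<subseteq> A" for n
  proof (induction n)
    case 0
    then show ?case by (simp add: S_def)
  next
    case (Suc n)
    moreover have "a n \<in> A" using a by blast
    ultimately show ?case using ext[of "S n @ [a n]"] by (auto simp: S_Suc)
  qed
  have S_len: "n \<le> length (S n)" for n
    by (induction n) (auto simp: S_Suc)
  have S_mono: "\<exists>t. S n = S m @ t" if "m \<le> n" for m n
    using that
  proof (induction rule: dec_induct)
    case base
    show ?case by simp
  next
    case (step n)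
    then show ?case by (auto simp: S_Suc)
  qed
  \<comment> \<open>\<open>f\<close> is the limit of the growing strings; \<open>S (Suc j)\<close>
    is already long enough to have a position \<open>j\<close>.\<close>
  define f where "f j = S (Suc j) ! j" for j
  have f_nth: "f j = S n ! j" if "j < length (S n)" for j n
  proof -
    have "j < length (S (Suc j))" using S_len[of "Suc j"] by simp
    then show ?thesis
      using S_mono[of n "Suc j"] S_mono[of "Suc j" n] that
      by (cases "n \<le> Suc j") (auto simp: f_def nth_append)
  qed
  have seg: "initial_segment f i = take i (S n)" if "i \<le> length (S n)" for i n
    using that f_nth by (intro nth_equalityI) (auto simp: initial_segment_def)
  have "content f = A"
  proof
    show "content f \<subseteq> A"
    proof
      fix x
      assume "x \<in> content f"
      then obtain j where "x = S (Suc j) ! j" by (auto simp: content_def f_def)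
      moreover have "j < length (S (Suc j))" using S_len[of "Suc j"] by simp
      ultimately show "x \<in> A" using S_sub by (meson nth_mem subsetD)
    qed
    show "A \<subseteq> content f"
    proof
      fix x
      assume "x \<in> A"
      then obtain n where "x = a n" using a by blast
      moreover have "f (length (S n)) = S (Suc n) ! length (S n)"
        by (rule f_nth) (simp add: S_Suc)
      ultimately have "f (length (S n)) = x" by (simp add: S_Suc nth_append)
      then show "x \<in> content f" by (auto simp: content_def)
    qed
  qed
  then have "TxtEx_identifies M f"
    using learns by (simp add: TxtEx_learns_def enumeration_of_def)
  then obtain v k where k: "\<And>i. k \<le> i \<Longrightarrow> M (initial_segment f i) = Some v"
    by (auto simp: TxtEx_identifies_def)
  \<comment> \<open>Both \<open>s\<close> and \<open>S (Suc k)\<close> are initial segments of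
    \<open>f\<close> of length at least \<open>k\<close>, so \<open>M\<close> outputs the limit
    \<open>v\<close> on both, although \<open>ext s\<close> was chosen to change the value.\<close>
  define s where "s = S k @ [a k]"
  have "k \<le> length s" using S_len[of k] by (simp add: s_def)
  then have "M (take (length s) (S (Suc k))) = Some v"
    using k[of "length s"] seg[of "length s" "Suc k"] by (simp add: S_Suc s_def)
  then have Ms: "M s = Some v" by (simp add: S_Suc s_def)
  have "M (S (Suc k)) = Some v"
    using k[of "length (S (Suc k))"] seg[of "length (S (Suc k))" "Suc k"] S_len[of "Suc k"] by simp
  then have "M (s @ ext s) = Some v" using Ms by (simp add: S_Suc s_def)
  moreover have "set s \<subseteq> A" using S_sub a by (auto simp: s_def)
  ultimately show False using ext[of s] Ms by simp
qed

lemma stabilizing_correct: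
  fixes a :: "nat \<Rightarrow> nat"
  assumes learns: "TxtEx_learns M A" and a: "range a = A"
    and s: "stabilizing M A s" and v: "M s = Some v"
  shows "W v = A"
proof -
  define f where "f j = (if j < length s then s ! j else a (j - length s))" for j
  have seg: "initial_segment f (length s + k) = s @ map a [0..<k]" for k
    by (rule nth_equalityI) (auto simp: initial_segment_def f_def nth_append)
  have "content f = A"
  proof
    have "f j \<in> A" for j
    proof (cases "j < length s")
      case True
      then have "f j \<in> set s" by (simp add: f_def)
      then show ?thesis using s by (auto simp: stabilizing_def)
    next
      case False
      then show ?thesis using a by (auto simp: f_def)
    qed
    then show "content f \<subseteq> A" by (auto simp: content_def)
    show "A \<subseteq> content f"
    proof
      fix x
      assume "x \<in> A"
      then obtain n where "x = a n" using a by blast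
      then have "f (length s + n) = x" by (simp add: f_def)
      then show "x \<in> content f" by (auto simp: content_def)
    qed
  qed
  then have "TxtEx_identifies M f"
    using learns by (simp add: TxtEx_learns_def enumeration_of_def)
  then obtain w k where k: "\<And>i. k \<le> i \<Longrightarrow> M (initial_segment f i) = Some w" and w: "W w = A"
    using \<open>content f = A\<close> by (auto simp: TxtEx_identifies_def)
  \<comment> \<open>A segment that extends \<open>s\<close> and lies past the point of convergence
    ties the limit \<open>w\<close>, an index of \<open>A\<close>, to the value on
    \<open>s\<close>.\<close>
  have "M (s @ map a [0..<k]) = Some w" using k[of "length s + k"] seg by simp
  moreover have "set (map a [0..<k]) \<subseteq> A" using a by auto
  ultimately have "M s = Some w" using s unfolding stabilizing_def by (metis option.distinct(1))
  with v w show ?thesis by simp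
qed

text \<open>
  Unlike \<open>TxtEx_learns\<close>, which quantifies over functions, this condition is arithmetical.
\<close>

definition stably_describes :: "nat \<Rightarrow> nat set \<Rightarrow> bool" where
  "stably_describes p A \<longleftrightarrow>
     (\<exists>s. stabilizing (\<lambda>s. phi p (list_encode s)) A (list_decode s)) \<and>
     (\<forall>s. stabilizing (\<lambda>s. phi p (list_encode s)) A (list_decode s) \<longrightarrow>
        (\<forall>v. phi p s = Some v \<longrightarrow> W v = A))"

lemma stably_describes_if_learns:
  assumes "TxtEx_learns (\<lambda>s. phi p (list_encode s)) A" and "A \<noteq> {}"
  shows "stably_describes p A"
proof -
  obtain b where "b \<in> A" using assms(2) by blast
  \<comment> \<open>The member \<open>b\<close> is a default value for the numbers outside
    \<open>A\<close>.\<close>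
  then have a: "range (\<lambda>n. if n \<in> A then n else b) = A" by auto
  show ?thesis
    unfolding stably_describes_def
    using stabilizing_ex[OF assms(1) a] stabilizing_correct[OF assms(1) a]
    by (metis list_decode_inverse list_encode_inverse)
qed

section \<open>Learning from the least stabilizing sequence\<close>

text \<open>The code \<open>c\<close> of the data seen so far also serves as the time bound.\<close>

definition candidate :: "nat \<Rightarrow> nat \<Rightarrow> nat \<Rightarrow> bool" where
  "candidate p c s \<longleftrightarrow> set (list_decode s) \<subseteq> set (list_decode c) \<and> halts_in p s c \<and>
     (\<forall>r<c. set (list_decode r) \<subseteq> set (list_decode c) \<and> halts_in p (append_code s r) c \<longrightarrow>
        result p (append_code s r) c = result p s c)"

text \<open>Ensures that the codes of the initial segments, used as time bounds, grow beyond every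
  number.\<close>

lemma length_le_list_encode: "length s \<le> list_encode s"
proof (induction s)
  case Nil
  then show ?case by simp
next
  case (Cons x s)
  then show ?case using le_prod_encode_2[of "list_encode s" x] by simp
qed

text \<open>On an enumeration of \<open>A\<close>, the least code \<open>s0\<close> of a stabilizing
  string is from some point on always a candidate, while each of the finitely many smaller codes is
  eventually rejected. The program \<open>q\<close> depends on \<open>p\<close> only, so it serves
  all sets \<open>A\<close> at once.\<close>

lemma learner:
  obtains q where "\<And>A. stably_describes p A \<Longrightarrow> TxtEx_learns (\<lambda>s. eval q (list_encode s)) A"
proof -
  have "decidable (\<lambda>z. candidate p (pi1 z) (pi2 z))"
    unfolding candidate_def by (intro computable_intros)
  then obtain q0 where q0: "\<And>c. eval q0 c =
      (if \<exists>s. candidate p c s then Some (LEAST s. candidate p c s) else None)"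
    by (rule computable_Least) blast
  have "computable (\<lambda>z. result p (pi2 z) (pi1 z))" by (intro computable_intros)
  then obtain q1 where q1: "\<And>z. eval q1 z = Some (result p (pi2 z) (pi1 z))"
    unfolding computable_def by blast
  \<comment> \<open>\<open>RPair RFst RSnd\<close> is the identity: \<open>q1\<close> receives the
    data \<open>c\<close> together with the least candidate for \<open>c\<close>.\<close>
  define q where "q = RComp q1 (RPair (RPair RFst RSnd) q0)"
  have q: "eval q c = Some (result p (LEAST s. candidate p c s) c)" if "candidate p c s" for c s
    using that by (auto simp: q_def q0 q1)
  have "TxtEx_learns (\<lambda>s. eval q (list_encode s)) A" if describes: "stably_describes p A" for A
    unfolding TxtEx_learns_def
  proof (intro allI impI)
    fix f
    assume "enumeration_of f A"
    then have f: "content f = A" by (simp add: enumeration_of_def)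
    define c where "c j = list_encode (initial_segment f j)" for j
    define st where "st s \<longleftrightarrow> stabilizing (\<lambda>s. phi p (list_encode s)) A (list_decode s)" for s
    have c_sub: "set (list_decode (c j)) \<subseteq> A" for j
      using f by (auto simp: c_def set_initial_segment content_def)
    have ev_ge: "\<forall>\<^sub>F j in sequentially. k \<le> c j" for k
    proof -
      have "j \<le> c j" for j
        using length_le_list_encode[of "initial_segment f j"] by (simp add: c_def initial_segment_def)
      then show ?thesis using order_trans by (intro eventually_sequentiallyI[of k]) blast
    qed
    have ev_sub: "\<forall>\<^sub>F j in sequentially. F \<subseteq> set (list_decode (c j))"
      if "finite F" "F \<subseteq> A" for F
    proof -
      have "\<forall>\<^sub>F j in sequentially. x \<in> set (list_decode (c j))" if "x \<in> F" for x
      proof -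
        have "x \<in> content f" using that \<open>F \<subseteq> A\<close> f by blast
        then obtain k where "f k = x" by (auto simp: content_def)
        then show ?thesis
          by (intro eventually_sequentiallyI[of "Suc k"]) (auto simp: c_def set_initial_segment)
      qed
      then have "\<forall>\<^sub>F j in sequentially. \<forall>x\<in>F. x \<in> set (list_decode (c j))"
        using \<open>finite F\<close> by (simp add: eventually_ball_finite)
      then show ?thesis by (simp add: subset_eq)
    qed
    have ev_halts: "\<forall>\<^sub>F j in sequentially. halts_in p s (c j)" if phi: "phi p s = Some v" for s v
    proof -
      obtain t where "halts_in p s t" using phi by (rule halts_in_ex)
      then show ?thesis using halts_in_mono by (intro eventually_mono[OF ev_ge[of t]])
    qed
    define s0 where "s0 = (LEAST s. st s)"
    obtain s where "st s" using describes by (auto simp: stably_describes_def st_def)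
    then have st0: "st s0" unfolding s0_def by (rule LeastI)
    then obtain v where v: "phi p s0 = Some v"
      by (auto simp: st_def stabilizing_def)
    have Wv: "W v = A" using describes st0 v by (auto simp: stably_describes_def st_def)
    have "\<forall>\<^sub>F j in sequentially. candidate p (c j) s0"
    proof -
      have "set (list_decode s0) \<subseteq> A" using st0 by (simp add: st_def stabilizing_def)
      then have "\<forall>\<^sub>F j in sequentially. set (list_decode s0) \<subseteq> set (list_decode (c j))"
        by (intro ev_sub) auto
      with ev_halts[OF v] show ?thesis
      proof eventually_elim
        case (elim j)
        \<comment> \<open>The data lie in \<open>A\<close>, so no tested extension of the
          stabilizing string can give another value.\<close>
        have "result p (append_code s0 r) (c j) = result p s0 (c j)"
          if "set (list_decode r) \<subseteq> set (list_decode (c j))" "halts_in p (append_code s0 r) (c j)" for r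
        proof -
          have "phi p (append_code s0 r) = phi p s0"
            using st0 subset_trans[OF that(1) c_sub] halts_in_phi[OF that(2)]
            by (simp add: st_def stabilizing_def append_code_def)
          then show ?thesis using halts_in_phi[OF that(2)] halts_in_phi[OF elim(1)] by simp
        qed
        then show ?case using elim by (auto simp: candidate_def)
      qed
    qed
    moreover have "\<forall>\<^sub>F j in sequentially. \<forall>s\<in>{..<s0}. \<not> candidate p (c j) s"
    proof (rule eventually_ball_finite[OF finite_lessThan], rule ballI)
      fix s
      assume "s \<in> {..<s0}"
      then have not_st: "\<not> st s" using not_less_Least unfolding s0_def by blast
      show "\<forall>\<^sub>F j in sequentially. \<not> candidate p (c j) s"
      proof (cases "set (list_decode s) \<subseteq> A \<and> phi p s \<noteq> None")
        case False
        \<comment> \<open>A candidate is a string over the data on which \<open>p\<close> halts, so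
          such an \<open>s\<close> is never one.\<close>
        then show ?thesis
          using c_sub halts_in_phi by (intro always_eventually) (fastforce simp: candidate_def)
      next
        case True
        with not_st obtain r' where r': "set r' \<subseteq> A" "phi p (list_encode (list_decode s @ r')) \<noteq> None"
          "phi p (list_encode (list_decode s @ r')) \<noteq> phi p s"
          by (auto simp: st_def stabilizing_def)
        define r where "r = list_encode r'"
        from r' have r: "set (list_decode r) \<subseteq> A" "phi p (append_code s r) \<noteq> None"
          "phi p (append_code s r) \<noteq> phi p s"
          by (simp_all add: r_def append_code_def)
        then obtain u w where uw: "phi p s = Some u" "phi p (append_code s r) = Some w" "u \<noteq> w"
          using True by auto
        \<comment> \<open>The extension \<open>r\<close> refutes \<open>s\<close> as soon as its
          elements have appeared, its code is below the bound \<open>c j\<close>, and the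
          computation on the extended string halts within that time.\<close>
        show ?thesis
          using ev_halts[OF uw(2)] ev_ge[of "Suc r"] ev_sub[OF finite_set r(1)]
        proof eventually_elim
          case (elim j)
          show ?case
          proof
            assume cand: "candidate p (c j) s"
            then have "result p (append_code s r) (c j) = result p s (c j)"
              using elim by (auto simp: candidate_def)
            moreover have "halts_in p s (c j)" using cand by (simp add: candidate_def)
            ultimately show False
              using uw halts_in_phi[OF elim(1)] halts_in_phi[of p s "c j"] by simp
          qed
        qed
      qed
    qed
    ultimately have "\<forall>\<^sub>F j in sequentially. eval q (list_encode (initial_segment f j)) = Some v"
    proof eventually_elim
      case (elim j)
      have "(LEAST s. candidate p (c j) s) = s0"
        using elim by (intro Least_equality) (auto simp: not_less[symmetric])
      then have "eval q (c j) = Some (result p s0 (c j))" using q[OF elim(1)] by simp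
      moreover have "halts_in p s0 (c j)" using elim(1) by (simp add: candidate_def)
      ultimately show ?case using halts_in_phi[of p s0 "c j"] v by (simp add: c_def)
    qed
    then show "TxtEx_identifies (\<lambda>s. eval q (list_encode s)) f"
      using Wv f by (auto simp: TxtEx_identifies_def eventually_sequentially)
  qed
  then show thesis by (rule that)
qed

text \<open>The program \<open>p\<close> on the right need not be a learner itself;
  \<open>learner\<close> converts it into one. Empty columns are set apart because the content of a
  total function is nonempty: every machine learns them vacuously.\<close>

lemma EXL_iff:
  "e \<in> EXL \<longleftrightarrow> (\<exists>p. \<forall>i. column e i = {} \<or> stably_describes p (column e i))"
proof
  assume "e \<in> EXL"
  then obtain M q where M: "\<forall>s. M s = eval q (list_encode s)"
    and learns: "\<forall>i. TxtEx_learns M (column e i)"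
    unfolding EXL_def TxtEx_learnable_def learning_machine_def TxtEx_learns_family_def
      uce_family_def by blast
  have "M = (\<lambda>s. eval q (list_encode s))" using M by (intro ext) blast
  with learns have "TxtEx_learns (\<lambda>s. phi (index q) (list_encode s)) (column e i)" for i
    by (simp only: phi_index)
  then have "\<forall>i. column e i = {} \<or> stably_describes (index q) (column e i)"
    using stably_describes_if_learns by blast
  then show "\<exists>p. \<forall>i. column e i = {} \<or> stably_describes p (column e i)" ..
next
  assume "\<exists>p. \<forall>i. column e i = {} \<or> stably_describes p (column e i)"
  then obtain p where p: "\<And>i. column e i = {} \<or> stably_describes p (column e i)" by blast
  obtain q where q: "\<And>A. stably_describes p A \<Longrightarrow> TxtEx_learns (\<lambda>s. eval q (list_encode s)) A"
    using learner[of p] by blast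
  have "TxtEx_learns (\<lambda>s. eval q (list_encode s)) (column e i)" for i
  proof (cases "column e i = {}")
    case True
    then show ?thesis by (auto simp: TxtEx_learns_def enumeration_of_def content_def)
  next
    case False
    then show ?thesis using p q by blast
  qed
  then show "e \<in> EXL"
    unfolding EXL_def TxtEx_learnable_def learning_machine_def TxtEx_learns_family_def
      uce_family_def mem_Collect_eq
    by (intro exI[of _ "\<lambda>s. eval q (list_encode s)"] conjI exI[of _ q]) auto
qed

section \<open>Counting the quantifiers\<close>

lemma stabilizing_code_iff:
  "stabilizing (\<lambda>s. phi p (list_encode s)) A (list_decode s) \<longleftrightarrow>
     set (list_decode s) \<subseteq> A \<and> s \<in> W p \<and>
     (\<forall>r. set (list_decode r) \<subseteq> A \<longrightarrow>
       (\<forall>u v. phi p s = Some u \<longrightarrow> phi p (append_code s r) = Some v \<longrightarrow> u = v))"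
proof -
  have all_decode: "(\<forall>r. P r) \<longleftrightarrow> (\<forall>r. P (list_decode r))" for P :: "nat list \<Rightarrow> bool"
    using surj_list_decode by (metis surjD)
  have decode: "stabilizing (\<lambda>s. phi p (list_encode s)) A (list_decode s) \<longleftrightarrow>
      set (list_decode s) \<subseteq> A \<and> phi p s \<noteq> None \<and>
      (\<forall>r. set (list_decode r) \<subseteq> A \<longrightarrow> phi p (append_code s r) \<noteq> None \<longrightarrow>
        phi p (append_code s r) = phi p s)"
    unfolding stabilizing_def append_code_def list_decode_inverse
    by (subst all_decode) (rule refl)
  \<comment> \<open>Comparing option values is replaced by comparing numbers \<open>u\<close> and
    \<open>v\<close> under premises of the form \<open>phi _ _ = Some _\<close>, the atoms for which
    closure rules exist.\<close>
  show ?thesis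
  proof (cases "phi p s = None")
    case True
    then show ?thesis by (simp add: decode W_def)
  next
    case False
    then have "(\<forall>u v. phi p s = Some u \<longrightarrow> x = Some v \<longrightarrow> u = v) \<longleftrightarrow>
        (x \<noteq> None \<longrightarrow> x = phi p s)" for x
      by (cases x) auto
    then show ?thesis by (simp only: decode W_def mem_Collect_eq)
  qed
qed

text \<open>Here \<open>x\<close> codes \<open>pair (pair (pair e p) i) s\<close>.\<close>

lemma stabilizing_complexity:
  assumes "1 < n"
  shows "Sigma_pred n (\<lambda>x. stabilizing (\<lambda>s. phi (pi2 (pi1 (pi1 x))) (list_encode s))
      (column (pi1 (pi1 (pi1 x))) (pi2 (pi1 x))) (list_decode (pi2 x)))" (is "Sigma_pred n ?P")
    and "Pi_pred n (\<lambda>x. stabilizing (\<lambda>s. phi (pi2 (pi1 (pi1 x))) (list_encode s))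
      (column (pi1 (pi1 (pi1 x))) (pi2 (pi1 x))) (list_decode (pi2 x)))"
proof -
  \<comment> \<open>The \<open>\<Sigma>\<^sub>1\<close> atoms occur only negated and
    \<open>u = v\<close> is decidable. The other two clauses are \<open>\<Sigma>\<^sub>1\<close>, so
    the whole condition lies in both \<open>\<Sigma>\<^sub>2\<close> and
    \<open>\<Pi>\<^sub>2\<close>.\<close>
  have stable: "Pi_pred 1 (\<lambda>x. \<forall>r. \<not> set (list_decode r) \<subseteq> column (pi1 (pi1 (pi1 x))) (pi2 (pi1 x)) \<or>
      (\<forall>u v. \<not> phi (pi2 (pi1 (pi1 x))) (pi2 x) = Some u \<or>
        \<not> phi (pi2 (pi1 (pi1 x))) (append_code (pi2 x) r) = Some v \<or> u = v))"
    by (intro Pi_pred_all arithmetical_intros decidable_Pi_pred[OF decidable_eq] computable_intros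
        zero_less_one)
  show "Sigma_pred n ?P"
    unfolding stabilizing_code_iff imp_conv_disj using assms
    by (intro arithmetical_intros computable_intros Sigma_pred_if_Pi[OF stable]) simp_all
  show "Pi_pred n ?P"
    unfolding stabilizing_code_iff imp_conv_disj using assms
    by (intro arithmetical_intros computable_intros Pi_pred_mono[OF stable]) simp_all
qed

lemma column_eq_empty_iff: "column e i = {} \<longleftrightarrow> (\<forall>x. \<not> pair i x \<in> W e)"
  by (auto simp: column_def)

lemma W_eq_column_iff:
  "W v = column e i \<longleftrightarrow>
     (\<forall>x. (\<not> x \<in> W v \<or> pair i x \<in> W e) \<and> (\<not> pair i x \<in> W e \<or> x \<in> W v))"
  by (auto simp: column_def)

theorem theorem3p1: "Sigma0 4 EXL"
proof -
  have empty: "Pi_pred 3 (\<lambda>x. column (pi1 (pi1 x)) (pi2 x) = {})"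
    unfolding column_eq_empty_iff
    by (intro Pi_pred_all arithmetical_intros computable_intros) simp_all
  have exists: "Pi_pred 3 (\<lambda>x. \<exists>s. stabilizing (\<lambda>s. phi (pi2 (pi1 x)) (list_encode s))
      (column (pi1 (pi1 x)) (pi2 x)) (list_decode s))"
    \<comment> \<open>The quantifier over \<open>s\<close> is absorbed by the
      \<open>\<Sigma>\<^sub>2\<close> form of stability, and \<open>\<Sigma>\<^sub>2\<close> is
      contained in \<open>\<Pi>\<^sub>3\<close>.\<close>
    by (rule Pi_pred_if_Sigma[of 2], rule Sigma_pred_ex)
      (use stabilizing_complexity(1)[of 2] in simp_all)
  have correct: "Pi_pred 3 (\<lambda>x. \<forall>s. stabilizing (\<lambda>s. phi (pi2 (pi1 x)) (list_encode s))
      (column (pi1 (pi1 x)) (pi2 x)) (list_decode s) \<longrightarrow>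
        (\<forall>v. phi (pi2 (pi1 x)) s = Some v \<longrightarrow> W v = column (pi1 (pi1 x)) (pi2 x)))"
    \<comment> \<open>The premise occurs negated, so its \<open>\<Sigma>\<close> form is the one
      used; equality of two c.e. sets is a universal statement about \<open>\<Sigma>\<^sub>1\<close>
      atoms and their negations.\<close>
    unfolding imp_conv_disj W_eq_column_iff
    by (intro Pi_pred_all Pi_pred_conj_disj(2) Pi_pred_not[THEN iffD2] stabilizing_complexity(1))
      (intro Pi_pred_all arithmetical_intros computable_intros | simp)+
  have "Pi_pred 3 (\<lambda>x. \<forall>i. column (pi1 x) i = {} \<or> stably_describes (pi2 x) (column (pi1 x) i))"
    unfolding stably_describes_def
    by (intro Pi_pred_all Pi_pred_conj_disj empty exists correct) simp
  \<comment> \<open>The quantifier over the program \<open>p\<close> in \<open>EXL_iff\<close> is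
    the one existential quantifier in front of the \<open>\<Pi>\<^sub>3\<close> matrix.\<close>
  from Sigma_pred_Pi_ex[OF this]
  have "Sigma_pred (Suc 3) (\<lambda>e. e \<in> EXL)" by (simp add: EXL_iff)
  then show ?thesis by (simp add: Sigma_pred_def)
qed

end
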